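(* Let $\alpha,\beta\in\mathbb{R}$ be such that neither is a negative integer and $\alpha+\beta>-1$. Let $u$ be a univalent sense-preserving $(\alpha,\beta)$-harmonic function on $\mathbb{D}$ with expansion $$u(z)=\sum_{k=0}^{\infty}c_{k}F(-\alpha,k-\beta;k+1;|z|^{2})z^{k}+\sum_{k=1}^{\infty}c_{-k}F(-\beta,k-\alpha;k+1;|z|^{2})\overline{z}^{k},$$ where all coefficients $c_k$ are real, $c_0=0$ and $c_1=1$. Then for $k=2,3,4,\ldots$ $$\left|\frac{\Gamma(1+\alpha)c_k}{\Gamma(k+1+\alpha)}-\frac{\Gamma(1+\beta)c_{-k}}{\Gamma(k+1+\beta)}\right|\leq\frac{1}{\Gamma(k)}\left|\frac{1}{1+\alpha}-\frac{c_{-1}}{1+\beta}\right|.$$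
   Context: $\mathbb{D}=\{z\in\mathbb{C}:|z|<1\}$. A complex-valued $u\in C^2(\mathbb{D})$ is $(\alpha,\beta)$-harmonic if $L_{\alpha,\beta}u=0$ on $\mathbb{D}$, where $$L_{\alpha,\beta}=(1-|z|^{2})\Big((1-|z|^{2})\frac{\partial^{2}}{\partial z\,\partial\overline z}+\alpha z\frac{\partial}{\partial z}+\beta\overline z\frac{\partial}{\partial\overline z}-\alpha\beta\Big).$$ It is known that $u$ is $(\alpha,\beta)$-harmonic if and only if it has a convergent expansion of the form displayed in the claim, for complex numbers $c_k$ ($k\in\mathbb{Z}$) with $\limsup_{|k|\to\infty}|c_k|^{1/|k|}\le 1$. Here $F(a,b;c;x)=\sum_{n\ge0}\frac{(a)_n(b)_n}{(c)_n}\frac{x^n}{n!}$ is the Gauss hypergeometric function. Univalent means injective; sense-preserving means $|u_z(z)|>|u_{\overline z}(z)|$ for all $z\in\mathbb{D}$. *)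

theory Defs
  imports "HOL-Analysis.Analysis"
begin

abbreviation unit_disc :: "complex set" where
  "unit_disc \<equiv> ball 0 1"

text \<open>
  All differentiability below is real differentiability of maps from the plane to itself:
  \<open>frechet_derivative f (at z)\<close> is the real-linear total derivative, so its values at \<open>1\<close> and
  \<open>\<i>\<close> are the partial derivatives \<open>f\<^sub>x\<close> and \<open>f\<^sub>y\<close>.
\<close>

definition partial_x :: "(complex \<Rightarrow> complex) \<Rightarrow> complex \<Rightarrow> complex" where
  "partial_x f z = frechet_derivative f (at z) 1"

definition partial_y :: "(complex \<Rightarrow> complex) \<Rightarrow> complex \<Rightarrow> complex" where
  "partial_y f z = frechet_derivative f (at z) \<i>"

text \<open>The following two notions are meant for open sets \<open>S\<close>.\<close>

definition C1_on :: "complex set \<Rightarrow> (complex \<Rightarrow> complex) \<Rightarrow> bool" where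
  "C1_on S f \<longleftrightarrow> (\<forall>z\<in>S. f differentiable (at z)) \<and>
     continuous_on S (partial_x f) \<and> continuous_on S (partial_y f)"

definition C2_on :: "complex set \<Rightarrow> (complex \<Rightarrow> complex) \<Rightarrow> bool" where
  "C2_on S f \<longleftrightarrow> C1_on S f \<and> C1_on S (partial_x f) \<and> C1_on S (partial_y f)"

definition wirtinger_z :: "(complex \<Rightarrow> complex) \<Rightarrow> complex \<Rightarrow> complex" where
  "wirtinger_z f z = (partial_x f z - \<i> * partial_y f z) / 2"

definition wirtinger_zbar :: "(complex \<Rightarrow> complex) \<Rightarrow> complex \<Rightarrow> complex" where
  "wirtinger_zbar f z = (partial_x f z + \<i> * partial_y f z) / 2"

definition L_op :: "real \<Rightarrow> real \<Rightarrow> (complex \<Rightarrow> complex) \<Rightarrow> complex \<Rightarrow> complex" where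
  "L_op \<alpha> \<beta> u z =
     of_real (1 - (cmod z)\<^sup>2) *
       (of_real (1 - (cmod z)\<^sup>2) * wirtinger_z (wirtinger_zbar u) z
        + of_real \<alpha> * z * wirtinger_z u z
        + of_real \<beta> * cnj z * wirtinger_zbar u z
        - of_real (\<alpha> * \<beta>) * u z)"

definition ab_harmonic :: "real \<Rightarrow> real \<Rightarrow> (complex \<Rightarrow> complex) \<Rightarrow> bool" where
  "ab_harmonic \<alpha> \<beta> u \<longleftrightarrow> C2_on unit_disc u \<and> (\<forall>z\<in>unit_disc. L_op \<alpha> \<beta> u z = 0)"

definition sense_preserving :: "(complex \<Rightarrow> complex) \<Rightarrow> bool" where
  "sense_preserving u \<longleftrightarrow> (\<forall>z\<in>unit_disc. cmod (wirtinger_z u z) > cmod (wirtinger_zbar u z))"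

definition hypergeo_F :: "real \<Rightarrow> real \<Rightarrow> real \<Rightarrow> real \<Rightarrow> real" where
  "hypergeo_F a b c x =
     (\<Sum>n. pochhammer a n * pochhammer b n / pochhammer c n * (x ^ n / fact n))"

definition pos_term :: "real \<Rightarrow> real \<Rightarrow> (int \<Rightarrow> complex) \<Rightarrow> complex \<Rightarrow> nat \<Rightarrow> complex" where
  "pos_term \<alpha> \<beta> c z k =
     c (int k) * of_real (hypergeo_F (- \<alpha>) (real k - \<beta>) (real k + 1) ((cmod z)\<^sup>2)) * z ^ k"

definition neg_term :: "real \<Rightarrow> real \<Rightarrow> (int \<Rightarrow> complex) \<Rightarrow> complex \<Rightarrow> nat \<Rightarrow> complex" where
  "neg_term \<alpha> \<beta> c z k =
     c (- int k) * of_real (hypergeo_F (- \<beta>) (real k - \<alpha>) (real k + 1) ((cmod z)\<^sup>2)) * cnj z ^ k"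

text \<open>
  The first series starts at \<open>k = 0\<close>, the second at \<open>k = 1\<close>. The filter
  \<open>filtercomap abs at_top\<close> on the integers expresses \<open>\<bar>k\<bar> \<longrightarrow> \<infinity>\<close>.
\<close>

definition has_ab_expansion ::
    "real \<Rightarrow> real \<Rightarrow> (complex \<Rightarrow> complex) \<Rightarrow> (int \<Rightarrow> complex) \<Rightarrow> bool" where
  "has_ab_expansion \<alpha> \<beta> u c \<longleftrightarrow>
     Limsup (filtercomap abs at_top) (\<lambda>k. ereal (root (nat \<bar>k\<bar>) (cmod (c k)))) \<le> 1 \<and>
     (\<forall>z\<in>unit_disc.
        summable (pos_term \<alpha> \<beta> c z) \<and>
        summable (\<lambda>k. neg_term \<alpha> \<beta> c z (Suc k)) \<and>
        u z = (\<Sum>k. pos_term \<alpha> \<beta> c z k) + (\<Sum>k. neg_term \<alpha> \<beta> c z (Suc k)))"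

end

theory Submission imports Defs begin

text \<open>
  Since the coefficients are real, \<open>u (cnj z) = cnj (u z)\<close>, so injectivity forces \<open>Im (u z) \<noteq> 0\<close>
  off the real axis. On each circle of radius \<open>r < 1\<close>, \<open>Im u\<close> is therefore a sine series of
  constant sign on \<open>(0, \<pi>)\<close>, and \<open>\<bar>sin (k t)\<bar> \<le> k sin t\<close> there bounds its \<open>k\<close>-th coefficient by
  \<open>k\<close> times the first one. As \<open>r\<close> tends to 1 the hypergeometric factors tend to their values at 1,
  given by Gauss's summation formula, and the bound becomes the claim.
\<close>

section \<open>Gauss's summation formula\<close>

text \<open>The power of \<open>x\<close> is left out, so that the value at 1 is the plain sum of
  the coefficients.\<close>

definition hypergeo_coeff :: "real \<Rightarrow> real \<Rightarrow> real \<Rightarrow> nat \<Rightarrow> real" where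
  "hypergeo_coeff a b c n = pochhammer a n * pochhammer b n / (pochhammer c n * fact n)"

lemma hypergeo_F_conv_coeff: "hypergeo_F a b c x = (\<Sum>n. hypergeo_coeff a b c n * x ^ n)"
  by (simp add: hypergeo_F_def hypergeo_coeff_def)

lemma hypergeo_coeff_Suc:
  "hypergeo_coeff a b c (Suc n) =
     hypergeo_coeff a b c n * ((a + real n) * (b + real n) / ((c + real n) * (1 + real n)))"
  by (simp add: hypergeo_coeff_def pochhammer_Suc mult_ac)

section \<open>Growth of the hypergeometric coefficients\<close>

lemma pochhammer_Suc_eq_rGamma_series:
  assumes "n > 0"
  shows "pochhammer z (Suc n) = rGamma_series z n * fact n * real n powr z"
  \<comment> \<open>\<open>rGamma_series\<close> is built with \<open>exp (z * ln n)\<close>,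
    whereas \<open>0 powr z\<close> is 0; hence \<open>n > 0\<close>.\<close>
  using assms by (simp add: rGamma_series_def powr_def)

text \<open>For \<open>n > 0\<close> the product equals
  \<open>rGamma_series a n * rGamma_series b n / rGamma_series c n\<close>, since the factor
  \<open>n + 1\<close> turns the factorial of \<open>Suc n\<close> into that of \<open>n\<close>.
  Thus the coefficients are at most of order \<open>n powr (a + b - c - 1)\<close>.\<close>

lemma hypergeo_coeff_asymptotics:
  assumes c: "c > 0"
  shows "(\<lambda>n. hypergeo_coeff a b c (Suc n) * (real n + 1) * real n powr (c - a - b))
           \<longlonglongrightarrow> rGamma a * rGamma b * Gamma c"
proof -
  have "(\<lambda>n. rGamma_series a n * rGamma_series b n / rGamma_series c n) \<longlonglongrightarrow>
          rGamma a * rGamma b / rGamma c"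
    using c by (intro tendsto_intros) (auto simp: rGamma_eq_zero_iff)
  moreover have "\<forall>\<^sub>F n in sequentially. rGamma_series a n * rGamma_series b n / rGamma_series c n =
      hypergeo_coeff a b c (Suc n) * (real n + 1) * real n powr (c - a - b)"
    using eventually_gt_at_top[of 0]
  proof eventually_elim
    case (elim n)
    have p: "pochhammer c (Suc n) > 0" using c by (rule pochhammer_pos)
    then have "rGamma_series c n \<noteq> 0"
      using pochhammer_Suc_eq_rGamma_series[OF elim, of c] by auto
    moreover have "real n powr (c - a - b) = real n powr c / (real n powr a * real n powr b)"
      by (simp add: powr_diff)
    moreover have "fact (Suc n) = (real n + 1) * fact n" by simp
    ultimately show ?case using elim
      unfolding hypergeo_coeff_def pochhammer_Suc_eq_rGamma_series[OF elim] by (simp del: fact_Suc)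
  qed
  ultimately show ?thesis
    by (auto elim: Lim_transform_eventually simp: Gamma_def field_simps)
qed

lemma hypergeo_coeff_decay:
  assumes "c > 0"
  obtains K where "\<And>n. n > 0 \<Longrightarrow>
    \<bar>hypergeo_coeff a b c (Suc n)\<bar> * (real n + 1) \<le> K * real n powr (a + b - c)"
proof -
  have "Bseq (\<lambda>n. hypergeo_coeff a b c (Suc n) * (real n + 1) * real n powr (c - a - b))"
    using convergentI[OF hypergeo_coeff_asymptotics[OF assms]] by (rule convergent_imp_Bseq)
  then obtain K where K: "\<And>n. \<bar>hypergeo_coeff a b c (Suc n) * (real n + 1) * real n powr (c - a - b)\<bar> \<le> K"
    unfolding Bseq_def by auto
  show thesis
  proof (rule that[of K])
    fix n :: nat assume n: "n > 0"
    have e: "real n powr (a + b - c) * real n powr (c - a - b) = 1"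
      using n by (simp flip: powr_add)
    have "\<bar>hypergeo_coeff a b c (Suc n)\<bar> * (real n + 1) * real n powr (c - a - b) \<le> K"
      using K[of n] by (simp add: abs_mult)
    then have "\<bar>hypergeo_coeff a b c (Suc n)\<bar> * (real n + 1) * real n powr (c - a - b) * real n powr (a + b - c)
      \<le> K * real n powr (a + b - c)"
      by (intro mult_right_mono) auto
    also have "\<bar>hypergeo_coeff a b c (Suc n)\<bar> * (real n + 1) * real n powr (c - a - b) * real n powr (a + b - c)
       = \<bar>hypergeo_coeff a b c (Suc n)\<bar> * (real n + 1)"
      using e by (simp add: mult_ac)
    finally show "\<bar>hypergeo_coeff a b c (Suc n)\<bar> * (real n + 1) \<le> K * real n powr (a + b - c)" .
  qed
qed

text \<open>The majorant \<open>n powr (a + b - c - 1)\<close> has exponent below -1 exactly when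
  \<open>c - a - b > 0\<close>.\<close>

lemma summable_abs_hypergeo_coeff:
  assumes c: "c > 0" and s: "c - a - b > 0"
  shows "summable (\<lambda>n. \<bar>hypergeo_coeff a b c n\<bar>)"
proof -
  obtain K where K: "\<And>n. n > 0 \<Longrightarrow>
    \<bar>hypergeo_coeff a b c (Suc n)\<bar> * (real n + 1) \<le> K * real n powr (a + b - c)"
    using hypergeo_coeff_decay[OF c] by blast
  have "summable (\<lambda>n. \<bar>hypergeo_coeff a b c (Suc n)\<bar>)"
  proof (rule summable_comparison_test_ev)
    show "summable (\<lambda>n. K * real n powr (a + b - c - 1))"
      using s by (intro summable_mult) (simp add: summable_real_powr_iff)
    show "\<forall>\<^sub>F n in sequentially. norm \<bar>hypergeo_coeff a b c (Suc n)\<bar> \<le> K * real n powr (a + b - c - 1)"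
      using eventually_gt_at_top[of 0]
    proof eventually_elim
      case (elim n)
      have "\<bar>hypergeo_coeff a b c (Suc n)\<bar> * real n \<le> \<bar>hypergeo_coeff a b c (Suc n)\<bar> * (real n + 1)"
        by (intro mult_left_mono) auto
      also note K[OF elim]
      finally have "\<bar>hypergeo_coeff a b c (Suc n)\<bar> \<le> K * real n powr (a + b - c) / real n"
        using elim by (simp add: pos_le_divide_eq)
      then show ?case using elim by (simp add: powr_diff[of "real n" "a + b - c" 1])
    qed
  qed
  then show ?thesis by (subst (asm) summable_Suc_iff)
qed

text \<open>This removes the boundary term at infinity when the contiguous relation is
  summed.\<close>

lemma hypergeo_coeff_times_n_tendsto_0:
  assumes c: "c > 0" and s: "c - a - b > 0"
  shows "(\<lambda>n. real n * hypergeo_coeff a b c n) \<longlonglongrightarrow> 0"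
proof -
  obtain K where K: "\<And>n. n > 0 \<Longrightarrow>
    \<bar>hypergeo_coeff a b c (Suc n)\<bar> * (real n + 1) \<le> K * real n powr (a + b - c)"
    using hypergeo_coeff_decay[OF c] by blast
  have "(\<lambda>n. real (Suc n) * hypergeo_coeff a b c (Suc n)) \<longlonglongrightarrow> 0"
  proof (rule Lim_null_comparison)
    show "\<forall>\<^sub>F n in sequentially. norm (real (Suc n) * hypergeo_coeff a b c (Suc n)) \<le> K * real n powr (a + b - c)"
      using eventually_gt_at_top[of 0]
      by eventually_elim (use K in \<open>simp add: abs_mult mult_ac add_ac\<close>)
    have "(\<lambda>n. real n powr (a + b - c)) \<longlonglongrightarrow> 0"
      using s by (intro tendsto_neg_powr filterlim_real_sequentially) auto
    then show "(\<lambda>n. K * real n powr (a + b - c)) \<longlonglongrightarrow> 0"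
      by (rule tendsto_mult_right_zero)
  qed
  then show ?thesis by (rule LIMSEQ_imp_Suc)
qed

text \<open>
  The last summand telescopes; this is the contiguous relation in \<open>c\<close> (Gauss) specialised to \<open>x = 1\<close>.
\<close>
lemma hypergeo_coeff_contiguous:
  assumes c: "c > 0"
  shows "(c - a) * (c - b) * hypergeo_coeff a b (c + 1) n =
    c * (c - a - b) * hypergeo_coeff a b c n +
    c * (real (Suc n) * hypergeo_coeff a b c (Suc n) - real n * hypergeo_coeff a b c n)"
proof -
  have "pochhammer c n * (c + real n) = c * pochhammer (c + 1) n"
    by (metis pochhammer_Suc pochhammer_rec)
  moreover have "pochhammer c n > 0" "pochhammer (c + 1) n > 0"
    using c by (auto intro: pochhammer_pos)
  \<comment> \<open>After this rewriting every term of the relation is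
    \<open>hypergeo_coeff a b c n\<close> times a rational function of \<open>n\<close>.\<close>
  ultimately have h: "hypergeo_coeff a b (c + 1) n = hypergeo_coeff a b c n * c / (c + real n)"
    using c by (simp add: hypergeo_coeff_def field_simps)
  show ?thesis
    unfolding h hypergeo_coeff_Suc using c
    by (simp add: divide_simps) (simp add: algebra_simps)
qed

text \<open>Summing the relation between coefficients, the telescoping part contributes nothing:
  \<open>n\<close> times the n-th coefficient is 0 at \<open>n = 0\<close> and tends to 0.\<close>

lemma hypergeo_sum_contiguous:
  assumes c: "c > 0" and s: "c - a - b > 0"
  shows "(c - a) * (c - b) * (\<Sum>n. hypergeo_coeff a b (c + 1) n) =
    c * (c - a - b) * (\<Sum>n. hypergeo_coeff a b c n)"
proof -
  have "summable (hypergeo_coeff a b (c + 1))"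
    using summable_abs_hypergeo_coeff[of "c + 1" a b] c s by (intro summable_rabs_cancel[of "hypergeo_coeff a b (c + 1)"]) auto
  then have 1: "(\<lambda>n. (c - a) * (c - b) * hypergeo_coeff a b (c + 1) n) sums
     ((c - a) * (c - b) * (\<Sum>n. hypergeo_coeff a b (c + 1) n))"
    by (intro sums_mult summable_sums)
  have "summable (hypergeo_coeff a b c)"
    using summable_abs_hypergeo_coeff[of c a b] c s by (intro summable_rabs_cancel[of "hypergeo_coeff a b c"]) auto
  then have 2: "(\<lambda>n. c * (c - a - b) * hypergeo_coeff a b c n +
      c * (real (Suc n) * hypergeo_coeff a b c (Suc n) - real n * hypergeo_coeff a b c n)) sums
     (c * (c - a - b) * (\<Sum>n. hypergeo_coeff a b c n) + c * (0 - real 0 * hypergeo_coeff a b c 0))"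
    by (intro sums_add sums_mult summable_sums telescope_sums hypergeo_coeff_times_n_tendsto_0 c s)
  show ?thesis using sums_unique2[OF 1] 2
    by (simp add: hypergeo_coeff_contiguous[OF c])
qed

lemma hypergeo_sum_shift:
  assumes c: "c > 0" and s: "c - a - b > 0"
  shows "pochhammer (c - a) m * pochhammer (c - b) m * (\<Sum>n. hypergeo_coeff a b (c + real m) n) =
    pochhammer c m * pochhammer (c - a - b) m * (\<Sum>n. hypergeo_coeff a b c n)"
proof (induction m)
  case (Suc m)
  have "pochhammer (c - a) (Suc m) * pochhammer (c - b) (Suc m) * (\<Sum>n. hypergeo_coeff a b (c + real (Suc m)) n)
    = pochhammer (c - a) m * pochhammer (c - b) m * ((c + real m - a) * (c + real m - b) * (\<Sum>n. hypergeo_coeff a b ((c + real m) + 1) n))"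
    by (simp add: pochhammer_Suc algebra_simps)
  also have "(c + real m - a) * (c + real m - b) * (\<Sum>n. hypergeo_coeff a b ((c + real m) + 1) n) =
    (c + real m) * (c + real m - a - b) * (\<Sum>n. hypergeo_coeff a b (c + real m) n)"
    by (rule hypergeo_sum_contiguous) (use c s in auto)
  also have "pochhammer (c - a) m * pochhammer (c - b) m * \<dots> =
    (c + real m) * (c - a - b + real m) * (pochhammer (c - a) m * pochhammer (c - b) m * (\<Sum>n. hypergeo_coeff a b (c + real m) n))"
    by (simp add: algebra_simps)
  also note Suc.IH
  finally show ?case by (simp add: pochhammer_Suc mult_ac)
qed auto

text \<open>Tannery's theorem: Pochhammer symbols grow with a positive parameter, so the case
  \<open>m = 0\<close> dominates, and every term except the zeroth tends to 0.\<close>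

lemma hypergeo_sum_tendsto_1:
  assumes c: "c > 0" and s: "c - a - b > 0"
  shows "(\<lambda>m. \<Sum>n. hypergeo_coeff a b (c + real m) n) \<longlonglongrightarrow> 1"
proof -
  have mono: "\<bar>hypergeo_coeff a b (c + real m) n\<bar> \<le> \<bar>hypergeo_coeff a b c n\<bar>" for m n
  proof -
    have "pochhammer c n \<le> pochhammer (c + real m) n"
      using c unfolding pochhammer_prod by (intro prod_mono) auto
    moreover have "pochhammer c n > 0" using c by (rule pochhammer_pos)
    ultimately show ?thesis
      unfolding hypergeo_coeff_def abs_mult abs_divide
      by (intro divide_left_mono mult_right_mono mult_pos_pos) auto
  qed
  have lim: "(\<lambda>m. hypergeo_coeff a b (c + real m) n) \<longlonglongrightarrow> (if n = 0 then 1 else 0)" for n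
  proof (cases n)
    case (Suc k)
    have "(\<lambda>m. pochhammer a n * pochhammer b n / fact n * (1 / pochhammer (c + real m) n)) \<longlonglongrightarrow>
      pochhammer a n * pochhammer b n / fact n * 0"
    proof (intro tendsto_mult tendsto_const)
      show "(\<lambda>m. 1 / pochhammer (c + real m) n) \<longlonglongrightarrow> 0"
      proof (rule Lim_null_comparison)
        \<comment> \<open>The first factor \<open>c + m\<close> of the Pochhammer symbol is at least
          \<open>m\<close>, and the remaining \<open>k\<close> factors are at least those of
          \<open>pochhammer (c + 1) k\<close>.\<close>
        show "\<forall>\<^sub>F m in sequentially. norm (1 / pochhammer (c + real m) n) \<le> (1 / pochhammer (c + 1) k) * (1 / real m)"
          using eventually_gt_at_top[of 0]
        proof eventually_elim
          case (elim m)
          have p: "pochhammer (c + 1) k > 0" using c by (intro pochhammer_pos) auto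
          have "pochhammer (c + 1) k \<le> pochhammer (c + real m + 1) k"
            using c unfolding pochhammer_prod by (intro prod_mono) auto
          then have "real m * pochhammer (c + 1) k \<le> (c + real m) * pochhammer (c + real m + 1) k"
            using c p by (intro mult_mono) auto
          then have "real m * pochhammer (c + 1) k \<le> pochhammer (c + real m) n"
            by (simp add: Suc pochhammer_rec)
          moreover have "real m * pochhammer (c + 1) k > 0" using p elim by auto
          ultimately show ?case by (simp add: frac_le mult.commute)
        qed
        show "(\<lambda>m. (1 / pochhammer (c + 1) k) * (1 / real m)) \<longlonglongrightarrow> 0"
          by (intro tendsto_mult_right_zero lim_1_over_n)
      qed
    qed
    then show ?thesis using Suc by (simp add: hypergeo_coeff_def mult_ac)
  qed (simp add: hypergeo_coeff_def)
  have "(\<lambda>m. \<Sum>n. hypergeo_coeff a b (c + real m) n) \<longlonglongrightarrow> (\<Sum>n. if n = 0 then 1 else 0)"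
    by (rule tannerys_theorem[OF lim _ summable_abs_hypergeo_coeff[OF c s], THEN conjunct2, THEN conjunct2])
       (use mono in \<open>auto intro: always_eventually\<close>)
  also have "(\<Sum>n. if n = 0 then 1 else (0::real)) = 1"
    using sums_single[of 0 "\<lambda>_. 1::real"] by (simp add: sums_iff)
  finally show ?thesis .
qed

text \<open>
  Raising \<open>c\<close> to \<open>c + m\<close> by the contiguous relation multiplies the sum by a quotient of Pochhammer
  symbols, which converges to the quotient of Gamma values as \<open>m \<rightarrow> \<infinity>\<close>.
\<close>
theorem Gauss_hypergeometric_sum:
  assumes c: "c > 0" and s: "c - a - b > 0"
  shows "(\<Sum>n. hypergeo_coeff a b c n) = Gamma c * Gamma (c - a - b) * rGamma (c - a) * rGamma (c - b)"
proof -
  let ?S = "\<lambda>m. \<Sum>n. hypergeo_coeff a b (c + real m) n"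
  let ?R = "\<lambda>m. rGamma_series (c - a) m * rGamma_series (c - b) m / (rGamma_series c m * rGamma_series (c - a - b) m)"
  \<comment> \<open>The shift is \<open>Suc m\<close> because \<open>rGamma_series z m\<close>
    contains \<open>pochhammer z (Suc m)\<close>.\<close>
  have "(\<lambda>m. ?R m * ?S (Suc m)) \<longlonglongrightarrow>
      rGamma (c - a) * rGamma (c - b) / (rGamma c * rGamma (c - a - b)) * 1"
    using c s LIMSEQ_Suc[OF hypergeo_sum_tendsto_1[OF c s]]
    by (intro tendsto_intros) (auto simp: rGamma_eq_zero_iff)
  moreover have "\<forall>\<^sub>F m in sequentially. ?R m * ?S (Suc m) = (\<Sum>n. hypergeo_coeff a b c n)"
    using eventually_gt_at_top[of 0]
  proof eventually_elim
    case (elim m)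
    have p: "pochhammer c (Suc m) > 0" "pochhammer (c - a - b) (Suc m) > 0"
      using c s by (auto intro: pochhammer_pos simp del: pochhammer_Suc)
    have nz: "rGamma_series c m \<noteq> 0" "rGamma_series (c - a - b) m \<noteq> 0"
      using p pochhammer_Suc_eq_rGamma_series[OF elim, of c] pochhammer_Suc_eq_rGamma_series[OF elim, of "c - a - b"]
      by auto
    \<comment> \<open>Both exponents add up to \<open>2 * c - a - b\<close>, so the powers of
      \<open>m\<close> and the factorials cancel from the quotient of Pochhammer symbols.\<close>
    have e: "real m powr (c - a) * real m powr (c - b) = real m powr c * real m powr (c - a - b)"
      by (simp flip: powr_add)
    let ?Q = "real m powr c * real m powr (c - a - b) * fact m * fact m"
    have "?Q \<noteq> 0" using elim by simp
    have "?Q * (rGamma_series (c - a) m * rGamma_series (c - b) m * ?S (Suc m)) =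
       pochhammer (c - a) (Suc m) * pochhammer (c - b) (Suc m) * ?S (Suc m)"
      unfolding pochhammer_Suc_eq_rGamma_series[OF elim] e[symmetric] by (simp add: mult_ac)
    also note hypergeo_sum_shift[OF c s, of "Suc m"]
    also have "pochhammer c (Suc m) * pochhammer (c - a - b) (Suc m) * (\<Sum>n. hypergeo_coeff a b c n) =
      ?Q * (rGamma_series c m * rGamma_series (c - a - b) m * (\<Sum>n. hypergeo_coeff a b c n))"
      unfolding pochhammer_Suc_eq_rGamma_series[OF elim] by (simp only: mult_ac)
    finally have "rGamma_series (c - a) m * rGamma_series (c - b) m * ?S (Suc m) =
      rGamma_series c m * rGamma_series (c - a - b) m * (\<Sum>n. hypergeo_coeff a b c n)"
      using \<open>?Q \<noteq> 0\<close> mult_cancel_left by blast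
    then show ?case using nz by (simp add: nonzero_divide_eq_eq mult_ac del: of_nat_Suc)
  qed
  ultimately have "(\<lambda>m::nat. \<Sum>n. hypergeo_coeff a b c n) \<longlonglongrightarrow>
      rGamma (c - a) * rGamma (c - b) / (rGamma c * rGamma (c - a - b))"
    by (auto elim: Lim_transform_eventually)
  then show ?thesis by (simp add: LIMSEQ_const_iff Gamma_def field_simps)
qed

text \<open>Absolute summability of the coefficients gives uniform convergence on the closed
  interval, hence continuity up to 1, where Gauss's formula supplies the value.\<close>

lemma hypergeo_F_tendsto_left_1:
  assumes c: "c > 0" and s: "c - a - b > 0"
  shows "((\<lambda>r. hypergeo_F a b c (r\<^sup>2)) \<longlongrightarrow> Gamma c * Gamma (c - a - b) * rGamma (c - a) * rGamma (c - b)) (at_left 1)"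
proof -
  have "continuous_on {0..1} (\<lambda>x. \<Sum>n. hypergeo_coeff a b c n * (x\<^sup>2) ^ n)"
  proof (rule uniform_limit_theorem)
    show "uniform_limit {0..1} (\<lambda>m x. \<Sum>n<m. hypergeo_coeff a b c n * (x\<^sup>2) ^ n) (\<lambda>x. \<Sum>n. hypergeo_coeff a b c n * (x\<^sup>2) ^ n) sequentially"
    proof (rule Weierstrass_m_test[OF _ summable_abs_hypergeo_coeff[OF c s]])
      fix n :: nat and x :: real assume "x \<in> {0..1}"
      then have "\<bar>(x\<^sup>2) ^ n\<bar> \<le> 1" by (simp add: power_abs power_le_one)
      then show "norm (hypergeo_coeff a b c n * (x\<^sup>2) ^ n) \<le> \<bar>hypergeo_coeff a b c n\<bar>"
        by (simp add: abs_mult mult_left_le)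
    qed
  qed (auto intro!: always_eventually continuous_intros)
  then have "((\<lambda>x. \<Sum>n. hypergeo_coeff a b c n * (x\<^sup>2) ^ n) \<longlongrightarrow> (\<Sum>n. hypergeo_coeff a b c n * (1\<^sup>2) ^ n)) (at 1 within {0..1})"
    unfolding continuous_on_def by (rule bspec) simp
  moreover have "at (1::real) within {0..1} = at_left 1"
    by (rule at_within_Icc_at_left) auto
  ultimately show ?thesis
    by (simp add: hypergeo_F_conv_coeff Gauss_hypergeometric_sum[OF c s])
qed

section \<open>Sine series of constant sign\<close>

lemma abs_sin_multiple_le: "\<bar>sin (real k * t)\<bar> \<le> real k * \<bar>sin (t::real)\<bar>"
proof (induction k)
  case (Suc k)
  have "\<bar>sin (real (Suc k) * t)\<bar> = \<bar>sin (real k * t) * cos t + cos (real k * t) * sin t\<bar>"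
    using sin_add[of "real k * t" t] by (simp add: algebra_simps)
  also have "\<dots> \<le> \<bar>sin (real k * t)\<bar> * \<bar>cos t\<bar> + \<bar>cos (real k * t)\<bar> * \<bar>sin t\<bar>"
    by (metis abs_mult abs_triangle_ineq)
  also have "\<dots> \<le> \<bar>sin (real k * t)\<bar> * 1 + 1 * \<bar>sin t\<bar>"
    by (intro add_mono mult_left_mono mult_right_mono) auto
  also have "\<dots> \<le> real (Suc k) * \<bar>sin t\<bar>" using Suc.IH by (simp add: algebra_simps)
  finally show ?case .
qed auto

text \<open>The frequency is an integer so that both \<open>m - k\<close> and \<open>m + k\<close>
  can be inserted in the product formula for sines.\<close>

lemma has_integral_cos_int_multiple:
  "((\<lambda>t. cos (of_int m * t)) has_integral (if m = 0 then pi else 0)) {0..pi}"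
proof (cases "m = 0")
  case True
  then show ?thesis using has_integral_const_real[of "1::real" 0 pi] by simp
next
  case False
  have "((\<lambda>t. cos (of_int m * t)) has_integral (sin (of_int m * pi) / of_int m - sin (of_int m * 0) / of_int m)) {0..pi}"
    by (rule fundamental_theorem_of_calculus)
       (use False in \<open>auto intro!: derivative_eq_intros simp flip: has_real_derivative_iff_has_vector_derivative\<close>)
  moreover have "sin (of_int m * pi) = 0" by (metis mult.commute sin_int_times_real sin_npi_int)
  ultimately show ?thesis using False by simp
qed

text \<open>The condition \<open>k > 0\<close> excludes \<open>m = k = 0\<close>, where the integral
  is 0 instead of \<open>pi / 2\<close>.\<close>

lemma has_integral_sin_mult_sin:
  assumes "k > 0"
  shows "((\<lambda>t. sin (real m * t) * sin (real k * t)) has_integral (if m = k then pi / 2 else 0)) {0..pi}"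
proof -
  have "((\<lambda>t. (cos (of_int (int m - int k) * t) - cos (of_int (int m + int k) * t)) / 2) has_integral
     (((if int m - int k = 0 then pi else 0) - (if int m + int k = 0 then pi else 0)) / 2)) {0..pi}"
    by (intro has_integral_divide has_integral_diff has_integral_cos_int_multiple)
  moreover have "(cos (of_int (int m - int k) * t) - cos (of_int (int m + int k) * t)) / 2
      = sin (real m * t) * sin (real k * t)" for t
    by (simp add: sin_times_sin left_diff_distrib distrib_right)
  ultimately show ?thesis using assms by (auto split: if_splits)
qed

text \<open>Absolute summability makes the series converge uniformly, so it may be integrated
  termwise; by orthogonality the integrals of the partial sums are constant as soon as they contain
  the k-th term.\<close>

lemma sine_series_coeff:
  fixes b :: "nat \<Rightarrow> real" and h :: "real \<Rightarrow> real"
  assumes b: "summable (\<lambda>k. \<bar>b k\<bar>)"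
    and h: "\<And>t. t \<in> {0..pi} \<Longrightarrow> (\<lambda>k. b k * sin (real k * t)) sums h t"
    and k: "k > 0"
  shows "((\<lambda>t. h t * sin (real k * t)) has_integral (b k * (pi / 2))) {0..pi}"
proof -
  let ?f = "\<lambda>m t. \<Sum>i<m. b i * (sin (real i * t) * sin (real k * t))"
  have "uniform_limit {0..pi} ?f (\<lambda>t. \<Sum>i. b i * (sin (real i * t) * sin (real k * t))) sequentially"
  proof (rule Weierstrass_m_test[OF _ b])
    fix n and t :: real
    have "\<bar>sin (real n * t)\<bar> * \<bar>sin (real k * t)\<bar> \<le> 1" by (intro mult_le_one) auto
    then show "norm (b n * (sin (real n * t) * sin (real k * t))) \<le> \<bar>b n\<bar>"
      by (simp add: abs_mult mult_left_le)
  qed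
  moreover have "(\<Sum>i. b i * (sin (real i * t) * sin (real k * t))) = h t * sin (real k * t)" if "t \<in> {0..pi}" for t
    using sums_mult2[OF h[OF that], of "sin (real k * t)"] by (simp add: sums_iff mult_ac)
  ultimately have "uniform_limit {0..pi} ?f (\<lambda>t. h t * sin (real k * t)) sequentially"
    by (subst (asm) uniform_limit_cong') auto
  then obtain I J where IJ: "\<And>m. (?f m has_integral I m) {0..pi}"
      "((\<lambda>t. h t * sin (real k * t)) has_integral J) {0..pi}" "I \<longlonglongrightarrow> J"
    by (rule uniform_limit_integral) (auto intro!: continuous_intros)
  have "I m = b k * (pi / 2)" if "m > k" for m
  proof -
    have "(?f m has_integral (\<Sum>i<m. b i * (if i = k then pi / 2 else 0))) {0..pi}"
      by (intro has_integral_sum has_integral_mult_right has_integral_sin_mult_sin k) auto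
    moreover have "(\<Sum>i<m. b i * (if i = k then pi / 2 else 0)) = b k * (pi / 2)"
      using that by (simp add: mult_delta_right)
    ultimately show ?thesis using has_integral_unique[OF IJ(1)[of m]] by simp
  qed
  then have "\<forall>\<^sub>F m in sequentially. I m = b k * (pi / 2)"
    using eventually_gt_at_top[of k] by (rule eventually_mono[rotated])
  then have "I \<longlonglongrightarrow> b k * (pi / 2)" by (rule tendsto_eventually)
  then show ?thesis using IJ LIMSEQ_unique by blast
qed

text \<open>Up to the factor \<open>pi / 2\<close>, \<open>b k\<close> and \<open>b 1\<close> are
  the integrals of \<open>h t\<close> against \<open>sin (k * t)\<close> and \<open>sin t\<close>.
  Since \<open>h\<close> is nonnegative, the pointwise bound of the first kernel by \<open>k\<close>
  times the second carries over to the integrals.\<close>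

lemma sine_series_coeff_bound_nonneg:
  fixes b :: "nat \<Rightarrow> real" and h :: "real \<Rightarrow> real"
  assumes b: "summable (\<lambda>k. \<bar>b k\<bar>)"
    and h: "\<And>t. t \<in> {0..pi} \<Longrightarrow> (\<lambda>k. b k * sin (real k * t)) sums h t"
    and nonneg: "\<And>t. t \<in> {0<..<pi} \<Longrightarrow> h t \<ge> 0"
    and k: "k > 0"
  shows "\<bar>b k\<bar> \<le> real k * b 1"
proof -
  \<comment> \<open>At the endpoints every sine vanishes, so \<open>h\<close> is 0 there and the
    sign holds on the whole interval of integration.\<close>
  have nonneg': "h t \<ge> 0" if "t \<in> {0..pi}" for t
  proof (cases "t = 0 \<or> t = pi")
    case True
    then have "h t = 0" using h[OF that] sums_unique2[OF sums_zero] by (auto simp: mult.commute)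
    then show ?thesis by simp
  qed (use that nonneg in auto)
  have le: "\<bar>h t * sin (real k * t)\<bar> \<le> h t * (real k * sin t)" if "t \<in> {0..pi}" for t
    using abs_sin_multiple_le[of k t] sin_ge_zero[of t] that nonneg'[OF that]
    by (simp add: abs_mult mult_left_mono)
  have 1: "((\<lambda>t. h t * (real k * sin t)) has_integral (real k * (b 1 * (pi / 2)))) {0..pi}"
    using has_integral_mult_right[OF sine_series_coeff[OF b h, of 1], of "real k"] by (simp add: mult_ac)
  have 2: "((\<lambda>t. h t * sin (real k * t)) has_integral (b k * (pi / 2))) {0..pi}"
    by (rule sine_series_coeff[OF b h k])
  have "b k * (pi / 2) \<le> real k * (b 1 * (pi / 2))"
    by (rule has_integral_le[OF 2 1]) (rule abs_le_D1[OF le])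
  moreover have "- (b k * (pi / 2)) \<le> real k * (b 1 * (pi / 2))"
    by (rule has_integral_le[OF has_integral_neg[OF 2] 1]) (rule abs_le_D2[OF le])
  ultimately have "\<bar>b k * (pi / 2)\<bar> \<le> real k * (b 1 * (pi / 2))"
    by (rule abs_leI)
  then have "\<bar>b k\<bar> * (pi / 2) \<le> (real k * b 1) * (pi / 2)"
    by (simp add: abs_mult)
  then show ?thesis by (rule mult_right_le_imp_le) simp
qed

lemma continuous_nonzero_constant_sign:
  fixes h :: "real \<Rightarrow> real"
  assumes cont: "continuous_on S h" and S: "connected S" and nz: "\<And>t. t \<in> S \<Longrightarrow> h t \<noteq> 0"
  shows "(\<forall>t\<in>S. h t \<ge> 0) \<or> (\<forall>t\<in>S. h t \<le> 0)"
proof (rule ccontr)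
  assume "\<not> ?thesis"
  then obtain s t where st: "s \<in> S" "h s < 0" "t \<in> S" "h t > 0" by force
  have "connected (h ` S)" using cont S by (rule connected_continuous_image)
  then have "0 \<in> h ` S"
    using st connectedD_interval[of "h ` S" "h s" "h t" 0] by auto
  then show False using nz by auto
qed

text \<open>As a uniform limit \<open>h\<close> is continuous, so without zeros it keeps one sign on
  the open interval. A negative sign is reduced to a positive one by negating \<open>b\<close> and
  \<open>h\<close>; hence the absolute value of \<open>b 1\<close>.\<close>

lemma sine_series_coeff_bound:
  fixes b :: "nat \<Rightarrow> real" and h :: "real \<Rightarrow> real"
  assumes b: "summable (\<lambda>k. \<bar>b k\<bar>)"
    and h: "\<And>t. t \<in> {0..pi} \<Longrightarrow> (\<lambda>k. b k * sin (real k * t)) sums h t"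
    and nz: "\<And>t. t \<in> {0<..<pi} \<Longrightarrow> h t \<noteq> 0"
    and k: "k > 0"
  shows "\<bar>b k\<bar> \<le> real k * \<bar>b 1\<bar>"
proof -
  have "continuous_on {0<..<pi} (\<lambda>t. \<Sum>i. b i * sin (real i * t))"
    by (rule uniform_limit_theorem[OF _ Weierstrass_m_test[OF _ b]])
       (auto intro!: always_eventually continuous_intros simp: abs_mult mult_left_le)
  then have "continuous_on {0<..<pi} h"
    by (rule continuous_on_eq) (use h in \<open>auto simp: sums_iff\<close>)
  then consider "\<forall>t\<in>{0<..<pi}. h t \<ge> 0" | "\<forall>t\<in>{0<..<pi}. h t \<le> 0"
    using continuous_nonzero_constant_sign[of "{0<..<pi}" h] nz connected_Ioo by blast
  then show ?thesis
  proof cases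
    case 1
    then have "\<bar>b k\<bar> \<le> real k * b 1"
      by (intro sine_series_coeff_bound_nonneg[OF b h _ k]) auto
    also have "\<dots> \<le> real k * \<bar>b 1\<bar>" by (intro mult_left_mono) auto
    finally show ?thesis .
  next
    case 2
    have "(\<lambda>j. - b j * sin (real j * t)) sums (- h t)" if "t \<in> {0..pi}" for t
      using sums_minus[OF h[OF that]] by simp
    then have "\<bar>- b k\<bar> \<le> real k * (- b 1)"
      using 2 b by (intro sine_series_coeff_bound_nonneg[of "\<lambda>j. - b j" "\<lambda>t. - h t"] k) auto
    also have "\<dots> \<le> real k * \<bar>b 1\<bar>" by (intro mult_left_mono) auto
    finally show ?thesis by simp
  qed
qed

section \<open>Convergence of the expansion on circles\<close>

text \<open>A root test along one half of the integers: \<open>e\<close> stands for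
  \<open>int k\<close> or \<open>- int k\<close>.\<close>

lemma summable_of_Limsup_root:
  fixes c :: "int \<Rightarrow> complex"
  assumes L: "Limsup (filtercomap abs at_top) (\<lambda>k. ereal (root (nat \<bar>k\<bar>) (cmod (c k)))) \<le> 1"
    and r: "0 \<le> r" "r < 1" and e: "\<And>k. \<bar>e k\<bar> = int k"
  shows "summable (\<lambda>k. cmod (c (e k)) * r ^ k)"
proof -
  \<comment> \<open>Any number above 1 whose product with \<open>r\<close> stays below 1 would do;
    the root bound \<open>y\<close> then yields a geometric majorant with ratio
    \<open>y * r\<close>.\<close>
  define y where "y = 2 / (1 + r)"
  have y: "y > 1" "0 \<le> y * r" "y * r < 1"
    using r by (auto simp: y_def field_simps)
  have "Limsup (filtercomap abs at_top) (\<lambda>k. ereal (root (nat \<bar>k\<bar>) (cmod (c k)))) < ereal y"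
    using L y(1) by (simp add: le_less_trans one_ereal_def)
  from Limsup_lessD[OF this] obtain N where
    N: "\<And>k::int. \<bar>k\<bar> \<ge> N \<Longrightarrow> root (nat \<bar>k\<bar>) (cmod (c k)) < y"
    by (auto simp: eventually_filtercomap eventually_at_top_linorder)
  show ?thesis
  proof (rule summable_comparison_test_ev)
    show "summable (\<lambda>k. (y * r) ^ k)" using y by (simp add: summable_geometric)
    show "\<forall>\<^sub>F k in sequentially. norm (cmod (c (e k)) * r ^ k) \<le> (y * r) ^ k"
      using eventually_ge_at_top[of "nat N"] eventually_gt_at_top[of 0]
    proof eventually_elim
      case (elim k)
      have "root k (cmod (c (e k))) \<le> y"
        using N[of "e k"] elim by (simp add: e less_imp_le nat_le_iff)
      then have "root k (cmod (c (e k))) ^ k \<le> y ^ k"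
        by (intro power_mono) (auto simp: real_root_ge_zero)
      then show ?case using elim r by (simp add: power_mult_distrib mult_right_mono)
    qed
  qed
qed

text \<open>Each factor is at most \<open>1 + \<bar>b\<bar> / (k + 1 + i)\<close>, which is largest
  for \<open>k = 0\<close>. The point is a bound independent of \<open>k\<close>.\<close>

lemma abs_pochhammer_ratio_le:
  "\<bar>pochhammer (real k - b) n / pochhammer (real k + 1) n\<bar> \<le> pochhammer (\<bar>b\<bar> + 1) n / fact n"
proof -
  have "\<bar>pochhammer (real k - b) n\<bar> / pochhammer (real k + 1) n
      = (\<Prod>i<n. \<bar>real k - b + real i\<bar> / (real k + 1 + real i))"
    by (simp add: pochhammer_prod prod_dividef abs_prod atLeast0LessThan)
  also have "\<dots> \<le> (\<Prod>i<n. (\<bar>b\<bar> + 1 + real i) / (1 + real i))"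
  proof (intro prod_mono conjI)
    fix i
    have "\<bar>real k - b + real i\<bar> / (real k + 1 + real i) \<le> (\<bar>b\<bar> + (real k + 1 + real i)) / (real k + 1 + real i)"
      by (intro divide_right_mono) auto
    also have "\<dots> = \<bar>b\<bar> / (real k + 1 + real i) + 1" by (simp add: add_divide_distrib)
    also have "\<dots> \<le> \<bar>b\<bar> / (1 + real i) + 1"
      by (intro add_mono divide_left_mono mult_pos_pos) auto
    also have "\<dots> = (\<bar>b\<bar> + 1 + real i) / (1 + real i)" by (simp add: field_simps)
    finally show "\<bar>real k - b + real i\<bar> / (real k + 1 + real i) \<le> (\<bar>b\<bar> + 1 + real i) / (1 + real i)" .
  qed auto
  also have "\<dots> = pochhammer (\<bar>b\<bar> + 1) n / fact n"
    by (simp add: pochhammer_fact pochhammer_prod prod_dividef atLeast0LessThan)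
  also have "\<bar>pochhammer (real k - b) n\<bar> / pochhammer (real k + 1) n = \<bar>pochhammer (real k - b) n / pochhammer (real k + 1) n\<bar>"
    using pochhammer_nonneg[of "real k + 1" n] by simp
  finally show ?thesis .
qed

lemma abs_pochhammer_le: "\<bar>pochhammer (a::real) n\<bar> \<le> pochhammer (\<bar>a\<bar> + 1) n"
  unfolding pochhammer_prod abs_prod by (intro prod_mono) auto

lemma shifted_ratio_tendsto_1: "(\<lambda>n. (p + real n) / (q + real n)) \<longlonglongrightarrow> 1"
proof -
  have lim: "filterlim (\<lambda>n. q + real n) at_top sequentially"
    by (intro filterlim_tendsto_add_at_top[OF tendsto_const] filterlim_real_sequentially)
  have "(\<lambda>n. 1 + (p - q) / (q + real n)) \<longlonglongrightarrow> 1 + 0"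
    by (intro tendsto_add tendsto_const tendsto_divide_0[OF tendsto_const] filterlim_at_top_imp_at_infinity lim)
  moreover have "\<forall>\<^sub>F n in sequentially. q + real n > 0"
    using lim by (simp add: filterlim_at_top_dense)
  then have "\<forall>\<^sub>F n in sequentially. 1 + (p - q) / (q + real n) = (p + real n) / (q + real n)"
    by eventually_elim (simp add: field_simps)
  ultimately show ?thesis by (auto elim: Lim_transform_eventually)
qed

text \<open>Ratio test: positive parameters keep all coefficients nonzero, and consecutive quotients
  tend to 1.\<close>

lemma summable_hypergeo_series:
  assumes a: "a > 0" and b: "b > 0" and c: "c > 0" and x: "0 \<le> x" "x < 1"
  shows "summable (\<lambda>n. hypergeo_coeff a b c n * x ^ n)"
proof (rule summable_in_conv_radius)
  have pos: "hypergeo_coeff a b c n > 0" for n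
    using assms unfolding hypergeo_coeff_def by (intro divide_pos_pos mult_pos_pos pochhammer_pos) auto
  have "conv_radius (hypergeo_coeff a b c) = 1"
  proof (rule conv_radius_ratio_limit)
    have "(\<lambda>n. ((c + real n) * (1 + real n)) / ((a + real n) * (b + real n))) \<longlonglongrightarrow> 1"
      using tendsto_mult[OF shifted_ratio_tendsto_1[of c a] shifted_ratio_tendsto_1[of 1 b]] by simp
    also have "(\<lambda>n. ((c + real n) * (1 + real n)) / ((a + real n) * (b + real n))) =
       (\<lambda>n. norm (hypergeo_coeff a b c n) / norm (hypergeo_coeff a b c (Suc n)))"
    proof
      fix n
      show "((c + real n) * (1 + real n)) / ((a + real n) * (b + real n)) =
        norm (hypergeo_coeff a b c n) / norm (hypergeo_coeff a b c (Suc n))"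
        using pos[of n] a b c by (simp add: hypergeo_coeff_Suc abs_mult)
    qed
    finally show "(\<lambda>n. norm (hypergeo_coeff a b c n) / norm (hypergeo_coeff a b c (Suc n))) \<longlonglongrightarrow> 1" .
  qed (use pos in \<open>auto intro: always_eventually simp: less_le one_ereal_def\<close>)
  then show "ereal (norm x) < conv_radius (hypergeo_coeff a b c)" using x by (simp add: one_ereal_def)
qed

text \<open>A single convergent hypergeometric series, with parameters
  \<open>\<bar>a\<bar> + 1\<close>, \<open>\<bar>b\<bar> + 1\<close> and 1, dominates the series for
  all \<open>k\<close> at once. The radial factors therefore do not disturb summability over
  \<open>k\<close>.\<close>

lemma hypergeo_F_bounded:
  assumes x: "0 \<le> x" "x < 1"
  obtains B where "\<And>k. \<bar>hypergeo_F a (real k - b) (real k + 1) x\<bar> \<le> B"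
proof
  fix k :: nat
  let ?M = "\<lambda>n. hypergeo_coeff (\<bar>a\<bar> + 1) (\<bar>b\<bar> + 1) 1 n * x ^ n"
  have M: "summable ?M" using x by (intro summable_hypergeo_series) auto
  have le: "norm (hypergeo_coeff a (real k - b) (real k + 1) n * x ^ n) \<le> ?M n" for n
  proof -
    have "\<bar>hypergeo_coeff a (real k - b) (real k + 1) n\<bar> =
      \<bar>pochhammer a n\<bar> / fact n * \<bar>pochhammer (real k - b) n / pochhammer (real k + 1) n\<bar>"
      by (simp add: hypergeo_coeff_def abs_mult)
    also have "\<dots> \<le> pochhammer (\<bar>a\<bar> + 1) n / fact n * (pochhammer (\<bar>b\<bar> + 1) n / fact n)"
      by (intro mult_mono divide_right_mono abs_pochhammer_le abs_pochhammer_ratio_le)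
         (auto intro!: divide_nonneg_pos pochhammer_nonneg)
    also have "\<dots> = hypergeo_coeff (\<bar>a\<bar> + 1) (\<bar>b\<bar> + 1) 1 n"
      by (simp add: hypergeo_coeff_def flip: pochhammer_fact)
    finally show ?thesis using x by (simp add: abs_mult mult_right_mono)
  qed
  have s: "summable (\<lambda>n. norm (hypergeo_coeff a (real k - b) (real k + 1) n * x ^ n))"
    by (rule summable_comparison_test'[OF M, of 0]) (use le in auto)
  then show "\<bar>hypergeo_F a (real k - b) (real k + 1) x\<bar> \<le> suminf ?M"
    unfolding hypergeo_F_conv_coeff
    using summable_norm[OF s] suminf_le[OF le s M] by simp
qed

section \<open>The imaginary part of the expansion\<close>

lemma Im_mult_cis: "Im (of_real x * cis t ^ k) = x * sin (real k * t)"
  by (simp add: Complex.DeMoivre)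

lemma Im_mult_cnj_cis: "Im (of_real x * cnj (cis t) ^ k) = - x * sin (real k * t)"
  by (simp add: cis_cnj Complex.DeMoivre)

lemma Im_pos_term_polar:
  assumes "c (int k) \<in> \<real>" "r \<ge> 0"
  shows "Im (pos_term \<alpha> \<beta> c (of_real r * cis t) k) =
    Re (c (int k)) * hypergeo_F (- \<alpha>) (real k - \<beta>) (real k + 1) (r\<^sup>2) * r ^ k * sin (real k * t)"
proof -
  have "pos_term \<alpha> \<beta> c (of_real r * cis t) k =
    of_real (Re (c (int k)) * hypergeo_F (- \<alpha>) (real k - \<beta>) (real k + 1) (r\<^sup>2) * r ^ k) * cis t ^ k"
    using assms by (simp add: pos_term_def norm_mult power_mult_distrib)
  then show ?thesis by (simp only: Im_mult_cis)
qed

lemma Im_neg_term_polar: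
  assumes "c (- int k) \<in> \<real>" "r \<ge> 0"
  shows "Im (neg_term \<alpha> \<beta> c (of_real r * cis t) k) =
    - (Re (c (- int k)) * hypergeo_F (- \<beta>) (real k - \<alpha>) (real k + 1) (r\<^sup>2) * r ^ k) * sin (real k * t)"
proof -
  have "neg_term \<alpha> \<beta> c (of_real r * cis t) k =
    of_real (Re (c (- int k)) * hypergeo_F (- \<beta>) (real k - \<alpha>) (real k + 1) (r\<^sup>2) * r ^ k) * cnj (cis t) ^ k"
    using assms by (simp add: neg_term_def norm_mult power_mult_distrib)
  then show ?thesis by (simp only: Im_mult_cnj_cis)
qed

text \<open>For real \<open>c\<close> these are the sine coefficients of \<open>Im u\<close> on the
  circle of radius \<open>r\<close>; conjugate powers give the minus sign. The entry at
  \<open>k = 0\<close> only multiplies \<open>sin 0\<close>.\<close>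

definition sine_coeff :: "real \<Rightarrow> real \<Rightarrow> (int \<Rightarrow> complex) \<Rightarrow> real \<Rightarrow> nat \<Rightarrow> real" where
  "sine_coeff \<alpha> \<beta> c r k =
     Re (c (int k)) * hypergeo_F (- \<alpha>) (real k - \<beta>) (real k + 1) (r\<^sup>2) * r ^ k -
     Re (c (- int k)) * hypergeo_F (- \<beta>) (real k - \<alpha>) (real k + 1) (r\<^sup>2) * r ^ k"

lemma Im_expansion_sums:
  assumes exp: "has_ab_expansion \<alpha> \<beta> u c" and real: "\<forall>k. c k \<in> \<real>" and r: "0 \<le> r" "r < 1"
  shows "(\<lambda>k. sine_coeff \<alpha> \<beta> c r k * sin (real k * t)) sums Im (u (of_real r * cis t))"
proof -
  let ?z = "of_real r * cis t :: complex"
  have "?z \<in> unit_disc" using r by (simp add: norm_mult)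
  then have s: "summable (pos_term \<alpha> \<beta> c ?z)" "summable (\<lambda>k. neg_term \<alpha> \<beta> c ?z (Suc k))"
    and u: "u ?z = (\<Sum>k. pos_term \<alpha> \<beta> c ?z k) + (\<Sum>k. neg_term \<alpha> \<beta> c ?z (Suc k))"
    using exp unfolding has_ab_expansion_def by blast+
  have "(\<lambda>k. Im (neg_term \<alpha> \<beta> c ?z (Suc k))) sums Im (\<Sum>k. neg_term \<alpha> \<beta> c ?z (Suc k))"
    by (intro sums_Im summable_sums s)
  \<comment> \<open>The second series starts at 1. Its added term at 0 has imaginary part 0, so both
    series can be indexed alike.\<close>
  moreover have "Im (neg_term \<alpha> \<beta> c ?z 0) = 0"
    using real r by (simp add: Im_neg_term_polar)
  ultimately have "(\<lambda>k. Im (neg_term \<alpha> \<beta> c ?z k)) sums Im (\<Sum>k. neg_term \<alpha> \<beta> c ?z (Suc k))"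
    by (subst (asm) sums_Suc_iff) simp
  then have "(\<lambda>k. Im (pos_term \<alpha> \<beta> c ?z k) + Im (neg_term \<alpha> \<beta> c ?z k)) sums Im (u ?z)"
    unfolding u plus_complex.sel by (rule sums_add[OF sums_Im[OF summable_sums[OF s(1)]]])
  then show ?thesis
    using real r by (simp add: Im_pos_term_polar Im_neg_term_polar sine_coeff_def left_diff_distrib)
qed

section \<open>Conjugation symmetry and univalence\<close>

lemma expansion_cnj:
  assumes exp: "has_ab_expansion \<alpha> \<beta> u c" and real: "\<forall>k. c k \<in> \<real>" and z: "z \<in> unit_disc"
  shows "u (cnj z) = cnj (u z)"
proof -
  have "cnj z \<in> unit_disc" using z by simp
  then have u': "u (cnj z) = (\<Sum>k. pos_term \<alpha> \<beta> c (cnj z) k) + (\<Sum>k. neg_term \<alpha> \<beta> c (cnj z) (Suc k))"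
    using exp unfolding has_ab_expansion_def by blast
  have s: "summable (pos_term \<alpha> \<beta> c z)" "summable (\<lambda>k. neg_term \<alpha> \<beta> c z (Suc k))"
    and u: "u z = (\<Sum>k. pos_term \<alpha> \<beta> c z k) + (\<Sum>k. neg_term \<alpha> \<beta> c z (Suc k))"
    using exp z unfolding has_ab_expansion_def by blast+
  have "cnj (c k) = c k" for k using real by (simp add: Reals_cnj_iff)
  \<comment> \<open>The hypergeometric factors are real and depend on \<open>cmod z\<close> only, so
    conjugation acts on the powers alone.\<close>
  then have "pos_term \<alpha> \<beta> c (cnj z) = (\<lambda>k. cnj (pos_term \<alpha> \<beta> c z k))"
    "neg_term \<alpha> \<beta> c (cnj z) = (\<lambda>k. cnj (neg_term \<alpha> \<beta> c z k))"
    by (simp_all add: fun_eq_iff pos_term_def neg_term_def)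
  moreover have "(\<Sum>k. cnj (pos_term \<alpha> \<beta> c z k)) = cnj (\<Sum>k. pos_term \<alpha> \<beta> c z k)"
    "(\<Sum>k. cnj (neg_term \<alpha> \<beta> c z (Suc k))) = cnj (\<Sum>k. neg_term \<alpha> \<beta> c z (Suc k))"
    using s by (simp_all add: sums_cnj sums_unique[symmetric] summable_sums)
  ultimately show ?thesis unfolding u' u by simp
qed

lemma Im_univalent_nonzero:
  assumes exp: "has_ab_expansion \<alpha> \<beta> u c" and real: "\<forall>k. c k \<in> \<real>"
    and inj: "inj_on u unit_disc" and z: "z \<in> unit_disc" "Im z \<noteq> 0"
  shows "Im (u z) \<noteq> 0"
proof
  assume "Im (u z) = 0"
  then have "u (cnj z) = u z"
    using expansion_cnj[OF exp real z(1)] by (simp add: complex_eq_iff)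
  then have "cnj z = z" using inj_onD[OF inj] z by simp
  then show False using z by (simp add: complex_eq_iff)
qed

text \<open>At fixed \<open>r\<close> the hypergeometric factors are bounded uniformly in
  \<open>k\<close>, and the root condition makes the remaining factors summable.\<close>

lemma summable_abs_sine_coeff:
  assumes exp: "has_ab_expansion \<alpha> \<beta> u c" and r: "0 \<le> r" "r < 1"
  shows "summable (\<lambda>k. \<bar>sine_coeff \<alpha> \<beta> c r k\<bar>)"
proof -
  have L: "Limsup (filtercomap abs at_top) (\<lambda>k. ereal (root (nat \<bar>k\<bar>) (cmod (c k)))) \<le> 1"
    using exp by (simp add: has_ab_expansion_def)
  have x: "0 \<le> r\<^sup>2" "r\<^sup>2 < 1" using r by (auto simp: power_less_one_iff abs_square_less_1)
  obtain A where A: "\<And>k. \<bar>hypergeo_F (- \<alpha>) (real k - \<beta>) (real k + 1) (r\<^sup>2)\<bar> \<le> A"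
    using hypergeo_F_bounded[OF x] by blast
  obtain B where B: "\<And>k. \<bar>hypergeo_F (- \<beta>) (real k - \<alpha>) (real k + 1) (r\<^sup>2)\<bar> \<le> B"
    using hypergeo_F_bounded[OF x] by blast
  show ?thesis
  proof (rule summable_comparison_test')
    show "summable (\<lambda>k. A * (cmod (c (int k)) * r ^ k) + B * (cmod (c (- int k)) * r ^ k))"
      by (intro summable_add summable_mult summable_of_Limsup_root[OF L r]) auto
    fix k :: nat
    have bound: "\<bar>Re w * F * r ^ k\<bar> \<le> C * (cmod w * r ^ k)" if "\<bar>F\<bar> \<le> C" for w F C
    proof -
      have "\<bar>Re w\<bar> * \<bar>F\<bar> * r ^ k \<le> cmod w * C * r ^ k"
        using that r abs_Re_le_cmod[of w] by (intro mult_mono mult_right_mono) auto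
      then show ?thesis using r by (simp add: abs_mult mult_ac)
    qed
    show "norm \<bar>sine_coeff \<alpha> \<beta> c r k\<bar> \<le> A * (cmod (c (int k)) * r ^ k) + B * (cmod (c (- int k)) * r ^ k)"
      unfolding sine_coeff_def real_norm_def abs_abs
      by (rule order_trans[OF abs_triangle_ineq4 add_mono[OF bound[OF A] bound[OF B]]])
  qed
qed

lemma sine_coeff_bound:
  assumes exp: "has_ab_expansion \<alpha> \<beta> u c" and real: "\<forall>k. c k \<in> \<real>"
    and inj: "inj_on u unit_disc" and r: "0 < r" "r < 1" and k: "k > 0"
  shows "\<bar>sine_coeff \<alpha> \<beta> c r k\<bar> \<le> real k * \<bar>sine_coeff \<alpha> \<beta> c r 1\<bar>"
proof (rule sine_series_coeff_bound[OF summable_abs_sine_coeff[OF exp] Im_expansion_sums[OF exp real] _ k])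
  fix t :: real assume "t \<in> {0<..<pi}"
  then have "Im (of_real r * cis t) \<noteq> 0" using r sin_gt_zero[of t] by simp
  then show "Im (u (of_real r * cis t)) \<noteq> 0"
    using r by (intro Im_univalent_nonzero[OF exp real inj]) (auto simp: norm_mult)
qed (use r in auto)

section \<open>Passage to the unit circle\<close>

lemma sine_coeff_tendsto:
  assumes "\<alpha> + \<beta> > -1"
  shows "((\<lambda>r. sine_coeff \<alpha> \<beta> c r k) \<longlongrightarrow> fact k * Gamma (1 + \<alpha> + \<beta>) *
     (Re (c (int k)) / (Gamma (real k + 1 + \<alpha>) * Gamma (1 + \<beta>)) -
      Re (c (- int k)) / (Gamma (real k + 1 + \<beta>) * Gamma (1 + \<alpha>)))) (at_left 1)"
proof -
  \<comment> \<open>Stated for \<open>a\<close> and \<open>b\<close> so that it applies to both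
    orders of \<alpha> and \<beta>. The excess in Gauss's formula is
    \<open>1 + \<alpha> + \<beta>\<close> for every \<open>k\<close>, positive by assumption. At a
    pole \<open>Gamma\<close> is 0, and division by 0 agrees with the value 0 of
    \<open>rGamma\<close>.\<close>
  have lim: "((\<lambda>r. hypergeo_F (- a) (real k - b) (real k + 1) (r\<^sup>2)) \<longlongrightarrow>
      fact k * Gamma (1 + \<alpha> + \<beta>) / (Gamma (real k + 1 + a) * Gamma (1 + b))) (at_left 1)"
    if "a + b = \<alpha> + \<beta>" for a b
  proof -
    have e: "real k + 1 - - a - (real k - b) = 1 + \<alpha> + \<beta>" "real k + 1 - (real k - b) = 1 + b"
      using that by auto
    have "Gamma (real k + 1) = fact k" by (metis Gamma_fact add.commute)
    then show ?thesis
      using hypergeo_F_tendsto_left_1[of "real k + 1" "- a" "real k - b"] assms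
      unfolding e by (simp add: rGamma_inverse_Gamma field_simps)
  qed
  have "((\<lambda>r. sine_coeff \<alpha> \<beta> c r k) \<longlongrightarrow>
    Re (c (int k)) * (fact k * Gamma (1 + \<alpha> + \<beta>) / (Gamma (real k + 1 + \<alpha>) * Gamma (1 + \<beta>))) * 1 ^ k -
    Re (c (- int k)) * (fact k * Gamma (1 + \<alpha> + \<beta>) / (Gamma (real k + 1 + \<beta>) * Gamma (1 + \<alpha>))) * 1 ^ k) (at_left 1)"
    unfolding sine_coeff_def by (intro tendsto_intros lim) auto
  then show ?thesis by (simp add: algebra_simps)
qed

theorem theorem2p2:
  fixes \<alpha> \<beta> :: real and u :: "complex \<Rightarrow> complex" and c :: "int \<Rightarrow> complex"
  assumes "\<forall>m::int. m < 0 \<longrightarrow> \<alpha> \<noteq> of_int m"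
    and "\<forall>m::int. m < 0 \<longrightarrow> \<beta> \<noteq> of_int m"
    and "\<alpha> + \<beta> > -1"
    and "ab_harmonic \<alpha> \<beta> u"
    and "inj_on u unit_disc"
    and "sense_preserving u"
    and "has_ab_expansion \<alpha> \<beta> u c"
    and "\<forall>k. c k \<in> \<real>"
    and "c 0 = 0"
    and "c 1 = 1"
  shows "\<forall>k::nat. k \<ge> 2 \<longrightarrow>
    cmod (of_real (Gamma (1 + \<alpha>)) * c (int k) / of_real (Gamma (real k + 1 + \<alpha>))
        - of_real (Gamma (1 + \<beta>)) * c (- int k) / of_real (Gamma (real k + 1 + \<beta>)))
    \<le> 1 / Gamma (real k) *
        cmod (of_real (1 / (1 + \<alpha>)) - c (-1) / of_real (1 + \<beta>))"
proof (intro allI impI)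
  fix k :: nat assume k: "k \<ge> 2"
  define p q where "p = Gamma (1 + \<alpha>)" and "q = Gamma (1 + \<beta>)"
  define G where "G = Gamma (1 + \<alpha> + \<beta>)"
  \<comment> \<open>\<open>X k\<close> is the quantity of the claim, and \<open>X 1\<close> that of
    its right-hand side. It arises from the limit of \<open>sine_coeff\<close> by taking out
    \<open>fact j * G / (p * q)\<close>.\<close>
  define X where "X j = p * Re (c (int j)) / Gamma (real j + 1 + \<alpha>) - q * Re (c (- int j)) / Gamma (real j + 1 + \<beta>)" for j
  have nonpole: "1 + x \<notin> \<int>\<^sub>\<le>\<^sub>0" if "\<forall>m::int. m < 0 \<longrightarrow> x \<noteq> of_int m" for x :: real
  proof
    assume "1 + x \<in> \<int>\<^sub>\<le>\<^sub>0"
    then obtain n where "1 + x = of_int n" "n \<le> 0" by (elim nonpos_Ints_cases)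
    then have "x = of_int (n - 1)" "n - 1 < 0" by auto
    then show False using that by blast
  qed
  \<comment> \<open>Off the poles \<open>p\<close> and \<open>q\<close> are nonzero, so the common
    factor can be formed and later cancelled.\<close>
  have pole: "1 + \<alpha> \<notin> \<int>\<^sub>\<le>\<^sub>0" "1 + \<beta> \<notin> \<int>\<^sub>\<le>\<^sub>0" using nonpole assms(1,2) by auto
  then have pq: "p \<noteq> 0" "q \<noteq> 0" by (auto simp: p_def q_def Gamma_eq_zero_iff)
  have G: "G > 0" using assms(3) by (auto simp: G_def intro: Gamma_real_pos)
  have lim: "((\<lambda>r. sine_coeff \<alpha> \<beta> c r j) \<longlongrightarrow> fact j * G / (p * q) * X j) (at_left 1)" for j
  proof -
    have "fact j * G * (Re (c (int j)) / (Gamma (real j + 1 + \<alpha>) * q) -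
      Re (c (- int j)) / (Gamma (real j + 1 + \<beta>) * p)) = fact j * G / (p * q) * X j"
      unfolding X_def using pq by (simp add: right_diff_distrib mult_ac)
    then show ?thesis
      using sine_coeff_tendsto[OF assms(3), of c j] by (simp only: p_def q_def G_def)
  qed
  have ev: "\<forall>\<^sub>F r in at_left (1::real). 0 < r \<and> r < 1"
    by (rule eventually_at_leftI[of 0]) auto
  have "\<bar>fact k * G / (p * q) * X k\<bar> \<le> real k * \<bar>fact 1 * G / (p * q) * X 1\<bar>"
  proof (rule tendsto_le)
    show "((\<lambda>r. \<bar>sine_coeff \<alpha> \<beta> c r k\<bar>) \<longlongrightarrow> \<bar>fact k * G / (p * q) * X k\<bar>) (at_left 1)"
      by (intro tendsto_rabs lim)
    show "((\<lambda>r. real k * \<bar>sine_coeff \<alpha> \<beta> c r 1\<bar>) \<longlongrightarrow> real k * \<bar>fact 1 * G / (p * q) * X 1\<bar>) (at_left 1)"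
      by (intro tendsto_mult_left tendsto_rabs lim)
    show "\<forall>\<^sub>F r in at_left 1. \<bar>sine_coeff \<alpha> \<beta> c r k\<bar> \<le> real k * \<bar>sine_coeff \<alpha> \<beta> c r 1\<bar>"
      using ev by eventually_elim (use sine_coeff_bound assms k in auto)
  qed auto
  then have "\<bar>G / (p * q)\<bar> * (fact k * \<bar>X k\<bar>) \<le> \<bar>G / (p * q)\<bar> * (real k * \<bar>X 1\<bar>)"
    by (simp add: abs_mult mult_ac)
  moreover have "\<bar>G / (p * q)\<bar> > 0" using G pq by simp
  ultimately have "fact k * \<bar>X k\<bar> \<le> real k * \<bar>X 1\<bar>" by (rule mult_left_le_imp_le)
  \<comment> \<open>Dividing \<open>k\<close> from the sine estimate by the factorial from Gauss's
    formula leaves \<open>1 / Gamma k\<close>.\<close>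
  moreover have "fact k = real k * Gamma (real k)"
    using k Gamma_fact[of "k - 1", where 'a = real] fact_reduce[of k, where 'a = real] by (simp add: of_nat_diff)
  ultimately have main: "\<bar>X k\<bar> \<le> 1 / Gamma (real k) * \<bar>X 1\<bar>"
    using k Gamma_real_pos[of "real k"] by (simp add: field_simps)
  have re: "of_real (Re (c j)) = c j" for j using assms(8) by simp
  have "of_real (X k) = of_real (Gamma (1 + \<alpha>)) * c (int k) / of_real (Gamma (real k + 1 + \<alpha>))
        - of_real (Gamma (1 + \<beta>)) * c (- int k) / of_real (Gamma (real k + 1 + \<beta>))"
    by (simp add: X_def p_def q_def re)
  moreover have "of_real (X 1) = of_real (1 / (1 + \<alpha>)) - c (-1) / of_real (1 + \<beta>)"
  proof -
    \<comment> \<open>The functional equation reduces both Gamma quotients at index 1 to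
      reciprocals, and \<open>c 1 = 1\<close> gives the first term.\<close>
    have "Gamma (1 + 1 + \<alpha>) = (1 + \<alpha>) * p" "Gamma (1 + 1 + \<beta>) = (1 + \<beta>) * q"
      using Gamma_plus1[OF pole(1)] Gamma_plus1[OF pole(2)] by (simp_all add: p_def q_def add_ac)
    then have "X 1 = 1 / (1 + \<alpha>) - Re (c (-1)) / (1 + \<beta>)"
      using pq assms(10) by (simp add: X_def)
    then show ?thesis by (simp add: re)
  qed
  ultimately show "cmod (of_real (Gamma (1 + \<alpha>)) * c (int k) / of_real (Gamma (real k + 1 + \<alpha>))
        - of_real (Gamma (1 + \<beta>)) * c (- int k) / of_real (Gamma (real k + 1 + \<beta>)))
    \<le> 1 / Gamma (real k) * cmod (of_real (1 / (1 + \<alpha>)) - c (-1) / of_real (1 + \<beta>))"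
    using main by (metis norm_of_real)
qed

end
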